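(* Let $\Lambda$ and $X$ be finite nonempty sets and let $\mathbf{Q}_1=\{q_t^z : t\in\Lambda,\ z\in X^{\Lambda\setminus\{t\}}\}$ be a family of functions $q_t^z: X^t\to\mathbb{R}$. The following are equivalent. (i) Every $q_t^z$ is a probability distribution on $X^t$ with $q_t^z(x)>0$ for all $x\in X^t$, and for all distinct $t,s\in\Lambda$ and all $x,u\in X^t$, $y,v\in X^s$, $z\in X^{\Lambda\setminus\{t,s\}}$, $$q_t^{zy}(x)\,q_s^{zx}(v)\,q_t^{zv}(u)\,q_s^{zu}(y)=q_t^{zy}(u)\,q_s^{zu}(v)\,q_t^{zv}(x)\,q_s^{zx}(y).$$ (ii) There is a one-point transition energy field $\mathbf{\Delta}_1=\{\Delta_t^z : t\in\Lambda,\ z\in X^{\Lambda\setminus\{t\}}\}$ in $\Lambda$ such that for all $t\in\Lambda$, $z\in X^{\Lambda\setminus\{t\}}$ and $u\in X^t$, $$q_t^z(x)=\frac{\exp\{\Delta_t^z(x,u)\}}{\sum_{\alpha\in X^t}\exp\{\Delta_t^z(\alpha,u)\}},\qquad x\in X^t .$$ Moreover, in this case the transition energy field $\mathbf{\Delta}_1$ is uniquely determined by $\mathbf{Q}_1$.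
   Context: Each point $t\in\Lambda$ is associated with a copy $X^t$ of $X$. For $V\subseteq\Lambda$, $X^V=\{(x_t)_{t\in V}: x_t\in X^t\}$ is the set of configurations on $V$ (with $X^\emptyset$ consisting of the empty configuration only), and $X^{\{t\}}$ is identified with $X^t$. For disjoint $V,I\subset\Lambda$ and $x\in X^V$, $y\in X^I$, $xy\in X^{V\cup I}$ denotes the concatenation: the configuration equal to $x$ on $V$ and to $y$ on $I$ (the order of writing is irrelevant). A (one-point) transition energy field in $\Lambda$ is a family $\mathbf{\Delta}_1=\{\Delta_t^z : t\in\Lambda,\ z\in X^{\Lambda\setminus\{t\}}\}$ of functions $\Delta_t^z: X^t\times X^t\to\mathbb{R}$ such that: (a) for all $t\in\Lambda$, $z\in X^{\Lambda\setminus\{t\}}$ and $x,u,\alpha\in X^t$: $\Delta_t^z(x,u)=\Delta_t^z(x,\alpha)+\Delta_t^z(\alpha,u)$; (b) for all distinct $t,s\in\Lambda$ and all $x,u\in X^t$, $y,v\in X^s$, $z\in X^{\Lambda\setminus\{t,s\}}$: $\Delta_t^{zy}(x,u)+\Delta_s^{zu}(y,v)=\Delta_s^{zx}(y,v)+\Delta_t^{zv}(x,u)$. *)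

theory Defs
  imports Complex_Main "HOL-Library.FuncSet"
begin

text \<open>
  The sets \<open>\<Lambda>\<close> (sites) and \<open>X\<close> (spin values) are explicit carriers. A configuration on
  \<open>V \<subseteq> \<Lambda>\<close> is a function from \<open>V\<close> to \<open>X\<close> that is \<open>undefined\<close> outside \<open>V\<close>, so that the only
  configuration on the empty set is the empty one. Configurations on \<open>{t}\<close> are identified
  with elements of \<open>X\<close>; for \<open>z\<close> a configuration on \<open>\<Lambda> - {t, s}\<close> and \<open>y \<in> X\<close> placed at the
  site \<open>s\<close>, the concatenation \<open>zy\<close> is the function update \<open>z(s := y)\<close>, a configuration on
  \<open>\<Lambda> - {t}\<close> whenever \<open>t \<noteq> s\<close> and \<open>s \<in> \<Lambda>\<close>.
\<close>

definition configs :: "'x set \<Rightarrow> 'l set \<Rightarrow> ('l \<Rightarrow> 'x) set" where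
  "configs X V = V \<rightarrow>\<^sub>E X"

text \<open>
  Families are total functions, \<open>q t z x\<close> standing for \<open>q_t^z(x)\<close> and \<open>\<Delta> t z x u\<close> for
  \<open>\<Delta>_t^z(x,u)\<close>. Only the values for \<open>t \<in> \<Lambda>\<close>, \<open>z\<close> a configuration on \<open>\<Lambda> - {t}\<close> and
  \<open>x, u \<in> X\<close> belong to the family.
\<close>

type_synonym ('l, 'x) distribution_family = "'l \<Rightarrow> ('l \<Rightarrow> 'x) \<Rightarrow> 'x \<Rightarrow> real"

type_synonym ('l, 'x) energy_family = "'l \<Rightarrow> ('l \<Rightarrow> 'x) \<Rightarrow> 'x \<Rightarrow> 'x \<Rightarrow> real"

definition transition_energy_field :: "'l set \<Rightarrow> 'x set \<Rightarrow> ('l, 'x) energy_family \<Rightarrow> bool" where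
  "transition_energy_field \<Lambda> X \<Delta> \<longleftrightarrow>
    (\<forall>t\<in>\<Lambda>. \<forall>z\<in>configs X (\<Lambda> - {t}). \<forall>x\<in>X. \<forall>u\<in>X. \<forall>\<alpha>\<in>X.
       \<Delta> t z x u = \<Delta> t z x \<alpha> + \<Delta> t z \<alpha> u) \<and>
    (\<forall>t\<in>\<Lambda>. \<forall>s\<in>\<Lambda>. t \<noteq> s \<longrightarrow>
       (\<forall>x\<in>X. \<forall>u\<in>X. \<forall>y\<in>X. \<forall>v\<in>X. \<forall>z\<in>configs X (\<Lambda> - {t, s}).
         \<Delta> t (z(s := y)) x u + \<Delta> s (z(t := u)) y v =
         \<Delta> s (z(t := x)) y v + \<Delta> t (z(s := v)) x u))"

definition probability_distribution_on :: "'x set \<Rightarrow> ('x \<Rightarrow> real) \<Rightarrow> bool" where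
  "probability_distribution_on X p \<longleftrightarrow> (\<forall>x\<in>X. 0 \<le> p x) \<and> (\<Sum>x\<in>X. p x) = 1"

definition positive_distributions :: "'l set \<Rightarrow> 'x set \<Rightarrow> ('l, 'x) distribution_family \<Rightarrow> bool" where
  "positive_distributions \<Lambda> X q \<longleftrightarrow>
    (\<forall>t\<in>\<Lambda>. \<forall>z\<in>configs X (\<Lambda> - {t}).
       probability_distribution_on X (q t z) \<and> (\<forall>x\<in>X. 0 < q t z x))"

definition consistent_family :: "'l set \<Rightarrow> 'x set \<Rightarrow> ('l, 'x) distribution_family \<Rightarrow> bool" where
  "consistent_family \<Lambda> X q \<longleftrightarrow>
    (\<forall>t\<in>\<Lambda>. \<forall>s\<in>\<Lambda>. t \<noteq> s \<longrightarrow>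
       (\<forall>x\<in>X. \<forall>u\<in>X. \<forall>y\<in>X. \<forall>v\<in>X. \<forall>z\<in>configs X (\<Lambda> - {t, s}).
         q t (z(s := y)) x * q s (z(t := x)) v * q t (z(s := v)) u * q s (z(t := u)) y =
         q t (z(s := y)) u * q s (z(t := u)) v * q t (z(s := v)) x * q s (z(t := x)) y))"

definition gibbs_form ::
    "'l set \<Rightarrow> 'x set \<Rightarrow> ('l, 'x) distribution_family \<Rightarrow> ('l, 'x) energy_family \<Rightarrow> bool" where
  "gibbs_form \<Lambda> X q \<Delta> \<longleftrightarrow>
    (\<forall>t\<in>\<Lambda>. \<forall>z\<in>configs X (\<Lambda> - {t}). \<forall>u\<in>X. \<forall>x\<in>X.
       q t z x = exp (\<Delta> t z x u) / (\<Sum>\<alpha>\<in>X. exp (\<Delta> t z \<alpha> u)))"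

end

theory Submission
  imports Defs
begin

text \<open>
  In Gibbs form, additivity of the energy forces \<open>\<Delta> t z x u = ln (q t z x) - ln (q t z u)\<close>, which
  gives uniqueness. Conversely these log-ratios are additive and reproduce the normalised
  distribution \<open>q t z\<close>, and taking logarithms turns the consistency condition for \<open>q\<close> into
  the exchange condition (b) for the log-ratios.
\<close>

definition log_ratio_energy :: "('l, 'x) distribution_family \<Rightarrow> ('l, 'x) energy_family" where
  "log_ratio_energy q t z x u = ln (q t z x) - ln (q t z u)"

lemma configs_update:
  assumes "z \<in> configs X (\<Lambda> - {t, s})" "s \<in> \<Lambda>" "t \<noteq> s" "y \<in> X"
  shows "z(s := y) \<in> configs X (\<Lambda> - {t})"
proof -
  have "\<Lambda> - {t} = insert s (\<Lambda> - {t, s})"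
    using assms by auto
  then show ?thesis
    using assms PiE_fun_upd[of y "\<lambda>_. X" s z "\<Lambda> - {t, s}"] by (simp add: configs_def)
qed

text \<open>\<open>ln\<close> is injective on the positive reals and turns products into sums. Four
  factors on each side is the shape of one instance of \<open>consistent_family\<close>.\<close>

lemma mult4_eq_iff_ln:
  fixes a b c d a' b' c' d' :: real
  assumes "0 < a" "0 < b" "0 < c" "0 < d" "0 < a'" "0 < b'" "0 < c'" "0 < d'"
  shows "a * b * c * d = a' * b' * c' * d' \<longleftrightarrow>
    ln a + ln b + ln c + ln d = ln a' + ln b' + ln c' + ln d'"
proof -
  have "a * b * c * d = a' * b' * c' * d' \<longleftrightarrow> ln (a * b * c * d) = ln (a' * b' * c' * d')"
    using assms by (intro ln_inj_iff[symmetric]) simp_all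
  then show ?thesis
    using assms by (simp add: ln_mult_pos)
qed

lemma positive_distributionsD:
  assumes "positive_distributions \<Lambda> X q" "t \<in> \<Lambda>" "z \<in> configs X (\<Lambda> - {t})"
  shows "x \<in> X \<Longrightarrow> 0 < q t z x" "sum (q t z) X = 1"
  using assms by (simp_all add: positive_distributions_def probability_distribution_on_def)

text \<open>Additivity of log-ratios is a telescoping identity, so only the exchange condition
  carries content. Moving its negative logarithms to the opposite sides leaves four logarithms on
  each side, which is the logarithm of the consistency equation for the same t, s, x, u, y, v,
  z.\<close>

lemma transition_energy_field_log_ratio_iff:
  assumes pos: "positive_distributions \<Lambda> X q"
  shows "transition_energy_field \<Lambda> X (log_ratio_energy q) \<longleftrightarrow> consistent_family \<Lambda> X q"
proof -
  have eq: "log_ratio_energy q t (z(s := y)) x u + log_ratio_energy q s (z(t := u)) y v =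
      log_ratio_energy q s (z(t := x)) y v + log_ratio_energy q t (z(s := v)) x u \<longleftrightarrow>
      q t (z(s := y)) x * q s (z(t := x)) v * q t (z(s := v)) u * q s (z(t := u)) y =
      q t (z(s := y)) u * q s (z(t := u)) v * q t (z(s := v)) x * q s (z(t := x)) y"
    if "t \<in> \<Lambda>" "s \<in> \<Lambda>" "t \<noteq> s" "x \<in> X" "u \<in> X" "y \<in> X" "v \<in> X"
      and z: "z \<in> configs X (\<Lambda> - {t, s})" for t s x u y v z
  proof -
    \<comment> \<open>The same z is updated at s to condition the site t and at t to condition the
      site s; the second use needs the roles of the two sites exchanged.\<close>
    have z': "z \<in> configs X (\<Lambda> - {s, t})"
      using z by (simp add: insert_commute)
    have qt: "0 < q t (z(s := b)) a" if "a \<in> X" "b \<in> X" for a b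
      using positive_distributionsD(1)[OF pos] configs_update[OF z] that \<open>t \<in> \<Lambda>\<close> \<open>s \<in> \<Lambda>\<close> \<open>t \<noteq> s\<close>
      by blast
    have qs: "0 < q s (z(t := a)) b" if "a \<in> X" "b \<in> X" for a b
      using positive_distributionsD(1)[OF pos] configs_update[OF z'] that \<open>t \<in> \<Lambda>\<close> \<open>s \<in> \<Lambda>\<close> \<open>t \<noteq> s\<close>
      by blast
    show ?thesis
      using that by (subst mult4_eq_iff_ln) (auto simp: qt qs log_ratio_energy_def)
  qed
  have add: "log_ratio_energy q t z x u = log_ratio_energy q t z x \<alpha> + log_ratio_energy q t z \<alpha> u"
    for t z x u \<alpha>
    by (simp add: log_ratio_energy_def)
  show ?thesis
  proof
    assume "transition_energy_field \<Lambda> X (log_ratio_energy q)"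
    then show "consistent_family \<Lambda> X q"
      unfolding consistent_family_def transition_energy_field_def
      by (intro ballI impI, intro eq[THEN iffD1]) blast+
  next
    assume "consistent_family \<Lambda> X q"
    then show "transition_energy_field \<Lambda> X (log_ratio_energy q)"
      unfolding consistent_family_def transition_energy_field_def
      by (intro conjI ballI impI add, intro eq[THEN iffD2]) blast+
  qed
qed

text \<open>Relative to the base point u, the exponentials are the ratios
  \<open>q t z a / q t z u\<close>. Since \<open>q t z\<close> sums to 1, they sum to
  \<open>1 / q t z u\<close>, and the factor \<open>q t z u\<close> cancels in the quotient.\<close>

lemma gibbs_form_log_ratio:
  assumes pos: "positive_distributions \<Lambda> X q"
  shows "gibbs_form \<Lambda> X q (log_ratio_energy q)"
  unfolding gibbs_form_def
proof (intro ballI)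
  fix t z u x
  assume tz: "t \<in> \<Lambda>" "z \<in> configs X (\<Lambda> - {t})" and "u \<in> X" "x \<in> X"
  note q = positive_distributionsD[OF pos tz]
  have e: "exp (log_ratio_energy q t z a u) = q t z a / q t z u" if "a \<in> X" for a
    using q(1)[OF that] q(1)[OF \<open>u \<in> X\<close>] by (simp add: log_ratio_energy_def exp_diff)
  have "(\<Sum>\<alpha>\<in>X. exp (log_ratio_energy q t z \<alpha> u)) = 1 / q t z u"
    using q(2) by (simp add: e flip: sum_divide_distrib)
  then show "q t z x = exp (log_ratio_energy q t z x u) /
      (\<Sum>\<alpha>\<in>X. exp (log_ratio_energy q t z \<alpha> u))"
    using e[OF \<open>x \<in> X\<close>] q(1)[OF \<open>u \<in> X\<close>] by simp
qed

lemma gibbs_form_positive: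
  assumes gibbs: "gibbs_form \<Lambda> X q \<Delta>" and X: "finite X" "X \<noteq> {}"
  shows "positive_distributions \<Lambda> X q"
proof -
  have "sum (q t z) X = 1 \<and> (\<forall>x\<in>X. 0 < q t z x)"
    if tz: "t \<in> \<Lambda>" "z \<in> configs X (\<Lambda> - {t})" for t z
  proof -
    \<comment> \<open>Any single base point will do: its Gibbs formula already writes
      \<open>q t z\<close> as positive weights divided by their total.\<close>
    obtain u where u: "u \<in> X"
      using X by blast
    have qx: "q t z x = exp (\<Delta> t z x u) / (\<Sum>\<alpha>\<in>X. exp (\<Delta> t z \<alpha> u))" if "x \<in> X" for x
      using gibbs tz u that unfolding gibbs_form_def by blast
    have Z: "0 < (\<Sum>\<alpha>\<in>X. exp (\<Delta> t z \<alpha> u))"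
      using X by (intro sum_pos) simp_all
    have "sum (q t z) X = (\<Sum>x\<in>X. exp (\<Delta> t z x u)) / (\<Sum>\<alpha>\<in>X. exp (\<Delta> t z \<alpha> u))"
      by (simp only: qx sum_divide_distrib cong: sum.cong)
    then show ?thesis
      using Z by (simp add: qx)
  qed
  then show ?thesis
    by (auto simp: positive_distributions_def probability_distribution_on_def less_imp_le)
qed

text \<open>Taking logarithms determines \<Delta>(a,u) up to a constant that depends on u but not on
  a. Additivity makes the energy vanish on the diagonal, and this fixes the constant.\<close>

lemma gibbs_form_energy_eq:
  assumes field: "transition_energy_field \<Lambda> X \<Delta>" and gibbs: "gibbs_form \<Lambda> X q \<Delta>"
    and X: "finite X" and tz: "t \<in> \<Lambda>" "z \<in> configs X (\<Lambda> - {t})" and xu: "x \<in> X" "u \<in> X"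
  shows "\<Delta> t z x u = log_ratio_energy q t z x u"
proof -
  let ?Z = "\<Sum>\<alpha>\<in>X. exp (\<Delta> t z \<alpha> u)"
  have Z: "0 < ?Z"
    using X xu by (intro sum_pos) auto
  have "ln (q t z a) = \<Delta> t z a u - ln ?Z" if "a \<in> X" for a
  proof -
    have "q t z a = exp (\<Delta> t z a u) / ?Z"
      using gibbs tz xu that unfolding gibbs_form_def by blast
    then show ?thesis
      using Z by (simp add: ln_div)
  qed
  \<comment> \<open>Additivity with all three arguments equal to u forces \<Delta>(u,u) = 0. The
    case a = u above then reads \<open>ln (q t z u) = - ln ?Z\<close>, which eliminates the
    normalising sum.\<close>
  moreover have "\<Delta> t z u u = \<Delta> t z u u + \<Delta> t z u u"
    using field tz xu unfolding transition_energy_field_def by blast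
  ultimately show ?thesis
    using xu by (simp add: log_ratio_energy_def)
qed

text \<open>Families are total functions with arbitrary values off the carriers, so two
  representations of one field need not be equal as functions. Both field conditions evaluate the
  family only at sites of \<Lambda>, configurations on the remaining sites and spins in X, so
  agreement there is enough.\<close>

lemma transition_energy_field_cong:
  assumes eq: "\<And>t z x u. t \<in> \<Lambda> \<Longrightarrow> z \<in> configs X (\<Lambda> - {t}) \<Longrightarrow> x \<in> X \<Longrightarrow> u \<in> X \<Longrightarrow>
      \<Delta> t z x u = \<Delta>' t z x u"
    and field: "transition_energy_field \<Lambda> X \<Delta>"
  shows "transition_energy_field \<Lambda> X \<Delta>'"
proof -
  have "\<Delta>' t (z(s := y)) x u + \<Delta>' s (z(t := u)) y v =
      \<Delta>' s (z(t := x)) y v + \<Delta>' t (z(s := v)) x u"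
    if "t \<in> \<Lambda>" "s \<in> \<Lambda>" "t \<noteq> s" "x \<in> X" "u \<in> X" "y \<in> X" "v \<in> X"
      and z: "z \<in> configs X (\<Lambda> - {t, s})" for t s x u y v z
  proof -
    have z': "z \<in> configs X (\<Lambda> - {s, t})"
      using z by (simp add: insert_commute)
    have "\<Delta> t (z(s := y)) x u + \<Delta> s (z(t := u)) y v =
        \<Delta> s (z(t := x)) y v + \<Delta> t (z(s := v)) x u"
      using field that unfolding transition_energy_field_def by blast
    then show ?thesis
      using that configs_update[OF z] configs_update[OF z'] by (simp add: eq)
  qed
  moreover have "\<Delta>' t z x u = \<Delta>' t z x \<alpha> + \<Delta>' t z \<alpha> u"
    if "t \<in> \<Lambda>" "z \<in> configs X (\<Lambda> - {t})" "x \<in> X" "u \<in> X" "\<alpha> \<in> X" for t z x u \<alpha>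
  proof -
    have "\<Delta> t z x u = \<Delta> t z x \<alpha> + \<Delta> t z \<alpha> u"
      using field that unfolding transition_energy_field_def by blast
    then show ?thesis
      using that by (simp add: eq)
  qed
  ultimately show ?thesis
    unfolding transition_energy_field_def by blast
qed

theorem theorem3:
  fixes \<Lambda> :: "'l set" and X :: "'x set" and q :: "('l, 'x) distribution_family"
  assumes "finite \<Lambda>" "\<Lambda> \<noteq> {}" "finite X" "X \<noteq> {}"
  shows "((positive_distributions \<Lambda> X q \<and> consistent_family \<Lambda> X q) \<longleftrightarrow>
          (\<exists>\<Delta>. transition_energy_field \<Lambda> X \<Delta> \<and> gibbs_form \<Lambda> X q \<Delta>)) \<and>
         (\<forall>\<Delta> \<Delta>'. transition_energy_field \<Lambda> X \<Delta> \<and> gibbs_form \<Lambda> X q \<Delta> \<and>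
                  transition_energy_field \<Lambda> X \<Delta>' \<and> gibbs_form \<Lambda> X q \<Delta>' \<longrightarrow>
            (\<forall>t\<in>\<Lambda>. \<forall>z\<in>configs X (\<Lambda> - {t}). \<forall>x\<in>X. \<forall>u\<in>X. \<Delta> t z x u = \<Delta>' t z x u))"
proof (intro conjI iffI)
  assume "positive_distributions \<Lambda> X q \<and> consistent_family \<Lambda> X q"
  then show "\<exists>\<Delta>. transition_energy_field \<Lambda> X \<Delta> \<and> gibbs_form \<Lambda> X q \<Delta>"
    using transition_energy_field_log_ratio_iff gibbs_form_log_ratio by blast
next
  assume "\<exists>\<Delta>. transition_energy_field \<Lambda> X \<Delta> \<and> gibbs_form \<Lambda> X q \<Delta>"
  then obtain \<Delta> where \<Delta>: "transition_energy_field \<Lambda> X \<Delta>" "gibbs_form \<Lambda> X q \<Delta>"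
    by blast
  show pos: "positive_distributions \<Lambda> X q"
    using gibbs_form_positive \<Delta>(2) assms(3,4) .
  \<comment> \<open>The given \<Delta> coincides with the log-ratio energy on the carriers, so the
    latter inherits the field property, from which consistency of q can be read off.\<close>
  have "transition_energy_field \<Lambda> X (log_ratio_energy q)"
    using gibbs_form_energy_eq[OF \<Delta> assms(3)] \<Delta>(1) by (rule transition_energy_field_cong)
  then show "consistent_family \<Lambda> X q"
    by (simp add: transition_energy_field_log_ratio_iff[OF pos])
next
  show "\<forall>\<Delta> \<Delta>'. transition_energy_field \<Lambda> X \<Delta> \<and> gibbs_form \<Lambda> X q \<Delta> \<and>
      transition_energy_field \<Lambda> X \<Delta>' \<and> gibbs_form \<Lambda> X q \<Delta>' \<longrightarrow>
      (\<forall>t\<in>\<Lambda>. \<forall>z\<in>configs X (\<Lambda> - {t}). \<forall>x\<in>X. \<forall>u\<in>X. \<Delta> t z x u = \<Delta>' t z x u)"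
    \<comment> \<open>Both energies are rewritten to the same log-ratio of q. Fixing q is essential,
      because the left side of the equation does not mention it.\<close>
    by (auto simp: gibbs_form_energy_eq[where q = q, OF _ _ assms(3)])
qed

end
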